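(* Let $X_t=\sigma W(\tau_t)$ and $\tilde X_t=X_t+\varepsilon_t$, where $\{\varepsilon_t\}_{t\ge 0}$ is a centered stationary noise process with finite moments of all orders, independent of $X$. For $K\ge 2$ let $$\hat{\bar\sigma}^2_{n,K}:=\frac{1}{K-1}\sum_{i=1}^K\frac1{T_{i,K}}[\tilde X,\tilde X]_2^{\mathcal G_n^{(i)}}-\frac{1}{(K-1)T}[\tilde X,\tilde X]_2^{\bar{\mathcal G}_n}.$$ Then $$\mathbb{E}\left(\hat{\bar\sigma}^2_{n,K}\right)=\sigma^2+\frac{\mathbb{E}(\tilde\varepsilon_{K\delta_n}^2)-\mathbb{E}(\tilde\varepsilon_{\delta_n}^2)}{\delta_n(K-1)} .$$ In particular, $\hat{\bar\sigma}^2_{n,K}$ is an asymptotically unbiased estimator of $\sigma^2$ if, for every $\ell\in\mathbb{N}$, $$\lim_{\delta_1,\delta_2\to0}\frac{\mathbb{E}[\tilde\varepsilon_{\delta_2}^{\ell}]-\mathbb{E}[\tilde\varepsilon_{\delta_1}^{\ell}]}{\delta_2-\delta_1}=0,$$ and it is an unbiased estimator of $\sigma^2$ if the noise is white, i.e. the variables $\{\varepsilon_t\}_{t\ge0}$ are i.i.d.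
   Context: $\sigma,\kappa>0$; $W$ is a standard Brownian motion; $\tau=\{\tau_t\}_{t\ge0}$ is a subordinator (non-decreasing Lévy process) independent of $W$ with $\mathbb{E}\tau_t=t$, $\mathrm{Var}(\tau_t)=\kappa t$, and $\mathbb{E}\tau_1^j<\infty$ for $j=1,\dots,8$. For a horizon $T>0$ and $n\in\mathbb{N}$: $\delta_n:=T/n$, $t_i:=i\delta_n$, $\bar{\mathcal G}_n:=\{t_0,\dots,t_n\}$. For $1\le i\le K$: $n_i:=\lfloor (n-i+1)/K\rfloor$, $\mathcal G_n^{(i)}:=\{t_{i-1},t_{i-1+K},t_{i-1+2K},\dots,t_{i-1+n_iK}\}$, $T_{i,K}:=K\delta_nn_i$; it is understood that $n_i\ge1$ for all $i$ (i.e. $n\ge 2K-1$). For a grid $\mathcal G=\{s_0<s_1<\dots<s_m\}$ and $\ell\in\mathbb{N}$, $[\tilde X,\tilde X]_\ell^{\mathcal G}:=\sum_{j=0}^{m-1}|\tilde X_{s_{j+1}}-\tilde X_{s_j}|^\ell$. For $\delta>0$, $\tilde\varepsilon_\delta$ denotes a random variable distributed as $\varepsilon_{t+\delta}-\varepsilon_t$ (the law does not depend on $t$). "Asymptotically unbiased" means the bias tends to $0$ as $\delta_n\to0$ and $K\delta_n\to0$ (in particular as $n\to\infty$ with $K$ and $T$ fixed). *)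

theory Defs
  imports "HOL-Probability.Probability"
begin

text \<open>
  Processes are functions \<open>X :: real \<Rightarrow> 'a \<Rightarrow> real\<close> whose time parameter ranges over \<open>{0..}\<close>;
  values at negative times are irrelevant.
\<close>

context prob_space
begin

definition stochastic_process :: "(real \<Rightarrow> 'a \<Rightarrow> real) \<Rightarrow> bool" where
  "stochastic_process X \<longleftrightarrow> (\<forall>t\<ge>0. random_variable borel (X t))"

text \<open>Independence of two processes as random elements of the path space \<open>\<real>\<^bsup>[0,\<infinity>)\<^esup>\<close>.
  By definition of \<^const>\<open>indep_var\<close> it includes measurability of every coordinate.\<close>

definition indep_processes :: "(real \<Rightarrow> 'a \<Rightarrow> real) \<Rightarrow> (real \<Rightarrow> 'a \<Rightarrow> real) \<Rightarrow> bool" where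
  "indep_processes X Y \<longleftrightarrow>
     indep_var (\<Pi>\<^sub>M t\<in>{0..}. borel) (\<lambda>\<omega>. \<lambda>t\<in>{0..}. X t \<omega>)
               (\<Pi>\<^sub>M t\<in>{0..}. borel) (\<lambda>\<omega>. \<lambda>t\<in>{0..}. Y t \<omega>)"

definition independent_increments :: "(real \<Rightarrow> 'a \<Rightarrow> real) \<Rightarrow> bool" where
  "independent_increments X \<longleftrightarrow>
     (\<forall>(t :: nat \<Rightarrow> real) m. 0 \<le> t 0 \<longrightarrow> mono t \<longrightarrow>
        indep_vars (\<lambda>_. borel) (\<lambda>i \<omega>. X (t (Suc i)) \<omega> - X (t i) \<omega>) {..<m})"

definition stationary_increments :: "(real \<Rightarrow> 'a \<Rightarrow> real) \<Rightarrow> bool" where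
  "stationary_increments X \<longleftrightarrow>
     (\<forall>t\<ge>0. \<forall>h\<ge>0. distr M borel (\<lambda>\<omega>. X (t + h) \<omega> - X t \<omega>)
                   = distr M borel (\<lambda>\<omega>. X h \<omega> - X 0 \<omega>))"

definition stochastically_continuous :: "(real \<Rightarrow> 'a \<Rightarrow> real) \<Rightarrow> bool" where
  "stochastically_continuous X \<longleftrightarrow>
     (\<forall>t\<ge>0. \<forall>e>0. ((\<lambda>s. prob {\<omega> \<in> space M. e < \<bar>X s \<omega> - X t \<omega>\<bar>}) \<longlongrightarrow> 0) (at t within {0..}))"

definition cadlag :: "(real \<Rightarrow> real) \<Rightarrow> bool" where
  "cadlag x \<longleftrightarrow>
     (\<forall>t\<ge>0. continuous (at_right t) x) \<and> (\<forall>t>0. \<exists>l. (x \<longlongrightarrow> l) (at_left t))"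

definition levy_process :: "(real \<Rightarrow> 'a \<Rightarrow> real) \<Rightarrow> bool" where
  "levy_process X \<longleftrightarrow>
     stochastic_process X \<and> (AE \<omega> in M. X 0 \<omega> = 0) \<and>
     independent_increments X \<and> stationary_increments X \<and>
     stochastically_continuous X \<and> (AE \<omega> in M. cadlag (\<lambda>t. X t \<omega>))"

definition subordinator :: "(real \<Rightarrow> 'a \<Rightarrow> real) \<Rightarrow> bool" where
  "subordinator \<tau> \<longleftrightarrow> levy_process \<tau> \<and> (AE \<omega> in M. mono_on {0..} (\<lambda>t. \<tau> t \<omega>))"

definition brownian_motion :: "(real \<Rightarrow> 'a \<Rightarrow> real) \<Rightarrow> bool" where
  "brownian_motion W \<longleftrightarrow>
     stochastic_process W \<and> (AE \<omega> in M. W 0 \<omega> = 0) \<and>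
     independent_increments W \<and>
     (\<forall>s t. 0 \<le> s \<longrightarrow> s < t \<longrightarrow>
        distributed M lborel (\<lambda>\<omega>. W t \<omega> - W s \<omega>) (normal_density 0 (sqrt (t - s)))) \<and>
     (AE \<omega> in M. continuous_on {0..} (\<lambda>t. W t \<omega>))"

text \<open>Strict stationarity: the finite-dimensional distributions are shift invariant.\<close>

definition stationary_process :: "(real \<Rightarrow> 'a \<Rightarrow> real) \<Rightarrow> bool" where
  "stationary_process \<epsilon> \<longleftrightarrow>
     (\<forall>h\<ge>0. \<forall>J. finite J \<longrightarrow> J \<subseteq> {0..} \<longrightarrow>
        distr M (\<Pi>\<^sub>M t\<in>J. borel) (\<lambda>\<omega>. \<lambda>t\<in>J. \<epsilon> (t + h) \<omega>)
      = distr M (\<Pi>\<^sub>M t\<in>J. borel) (\<lambda>\<omega>. \<lambda>t\<in>J. \<epsilon> t \<omega>))"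

definition noise_process :: "(real \<Rightarrow> 'a \<Rightarrow> real) \<Rightarrow> bool" where
  "noise_process \<epsilon> \<longleftrightarrow>
     stochastic_process \<epsilon> \<and> stationary_process \<epsilon> \<and>
     (\<forall>t\<ge>0. expectation (\<epsilon> t) = 0) \<and>
     (\<forall>t\<ge>0. \<forall>k::nat. integrable M (\<lambda>\<omega>. \<bar>\<epsilon> t \<omega>\<bar> ^ k))"

definition white_noise :: "(real \<Rightarrow> 'a \<Rightarrow> real) \<Rightarrow> bool" where
  "white_noise \<epsilon> \<longleftrightarrow>
     indep_vars (\<lambda>_. borel) \<epsilon> {0..} \<and>
     (\<forall>s\<ge>0. \<forall>t\<ge>0. distr M borel (\<epsilon> s) = distr M borel (\<epsilon> t))"

end

text \<open>A grid \<open>s\<^sub>0 < \<dots> < s\<^sub>m\<close> is the list of its points in increasing order.\<close>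

definition power_variation :: "nat \<Rightarrow> (real \<Rightarrow> 'a \<Rightarrow> real) \<Rightarrow> real list \<Rightarrow> 'a \<Rightarrow> real" where
  "power_variation l X G \<omega> = (\<Sum>j<length G - 1. \<bar>X (G ! Suc j) \<omega> - X (G ! j) \<omega>\<bar> ^ l)"

definition mesh :: "real \<Rightarrow> nat \<Rightarrow> real" where
  "mesh T n = T / real n"

definition full_grid :: "real \<Rightarrow> nat \<Rightarrow> real list" where
  "full_grid T n = map (\<lambda>j. real j * mesh T n) [0..<Suc n]"

definition sub_count :: "nat \<Rightarrow> nat \<Rightarrow> nat \<Rightarrow> nat" where
  "sub_count n K i = (n + 1 - i) div K"

definition sub_grid :: "real \<Rightarrow> nat \<Rightarrow> nat \<Rightarrow> nat \<Rightarrow> real list" where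
  "sub_grid T n K i = map (\<lambda>j. real (i - 1 + j * K) * mesh T n) [0..<Suc (sub_count n K i)]"

definition sub_horizon :: "real \<Rightarrow> nat \<Rightarrow> nat \<Rightarrow> nat \<Rightarrow> real" where
  "sub_horizon T n K i = real K * mesh T n * real (sub_count n K i)"

definition two_scale_estimator ::
    "(real \<Rightarrow> 'a \<Rightarrow> real) \<Rightarrow> real \<Rightarrow> nat \<Rightarrow> nat \<Rightarrow> 'a \<Rightarrow> real" where
  "two_scale_estimator Y T n K \<omega> =
     1 / (real K - 1) *
       (\<Sum>i=1..K. 1 / sub_horizon T n K i * power_variation 2 Y (sub_grid T n K i) \<omega>)
     - 1 / ((real K - 1) * T) * power_variation 2 Y (full_grid T n) \<omega>"

text \<open>\<open>n \<ge> 2 K - 1\<close> says exactly that \<open>sub_count n K i \<ge> 1\<close> for all \<open>1 \<le> i \<le> K\<close>.\<close>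

definition admissible :: "real \<Rightarrow> nat \<Rightarrow> nat \<Rightarrow> bool" where
  "admissible T n K \<longleftrightarrow> 0 < T \<and> 2 \<le> K \<and> 2 * K - 1 \<le> n"

text \<open>The regime \<open>\<delta>\<^sub>n \<rightarrow> 0\<close>, \<open>K \<delta>\<^sub>n \<rightarrow> 0\<close>, where \<open>T\<close>, \<open>n\<close> and \<open>K\<close> may all vary.\<close>

definition small_mesh :: "(real \<times> nat \<times> nat) filter" where
  "small_mesh =
     inf (filtercomap (\<lambda>(T, n, K). mesh T n) (at_right 0))
    (inf (filtercomap (\<lambda>(T, n, K). real K * mesh T n) (at_right 0))
         (principal {(T, n, K). admissible T n K}))"

definition unbiased :: "'a measure \<Rightarrow> ('a \<Rightarrow> real) \<Rightarrow> real \<Rightarrow> bool" where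
  "unbiased M est \<theta> \<longleftrightarrow> integrable M est \<and> integral\<^sup>L M est = \<theta>"

definition asymptotically_unbiased ::
    "'a measure \<Rightarrow> (real \<Rightarrow> nat \<Rightarrow> nat \<Rightarrow> 'a \<Rightarrow> real) \<Rightarrow> real \<Rightarrow> bool" where
  "asymptotically_unbiased M est \<theta> \<longleftrightarrow>
     ((\<lambda>(T, n, K). integral\<^sup>L M (est T n K) - \<theta>) \<longlongrightarrow> 0) small_mesh"

text \<open>The pairs \<open>(\<delta>\<^sub>1, \<delta>\<^sub>2)\<close> of distinct positive numbers tending to \<open>0\<close>.\<close>

definition small_pairs :: "(real \<times> real) filter" where
  "small_pairs = inf (at_right 0 \<times>\<^sub>F at_right 0) (principal {(d1, d2). d1 \<noteq> d2})"

end

theory Submission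
  imports Defs "HOL-Real_Asymp.Real_Asymp"
begin

text \<open>
  By independence, an increment of \<open>X + \<epsilon>\<close> over a lag \<open>h\<close> has second moment
  \<open>v h = \<sigma>\<^sup>2 h + E (\<epsilon>\<^sub>h - \<epsilon>\<^sub>0)\<^sup>2\<close>; the average over each subgrid is \<open>v (K \<delta>) / (K \<delta>)\<close>, over the full
  grid it is \<open>v \<delta> / \<delta>\<close>, and the combination of the two scales leaves \<open>\<sigma>\<^sup>2\<close> plus the noise
  difference quotient at \<open>(\<delta>, K \<delta>)\<close>.

  Evaluation of a path at a random time is not measurable on the path space, so the identity
  \<open>E (W(\<tau>\<^sub>t) - W(\<tau>\<^sub>s))\<^sup>2 = t - s\<close> is first obtained for random times rounded up to
  a grid of mesh \<open>1/(k+1)\<close>, where Fubini applies to the joint law of \<open>(W, \<tau>)\<close>. Path continuity and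
  Fatou's lemma bound the rounding error in \<open>L\<^sup>2\<close> by \<open>1/(k+1)\<close>, so the second moments converge.
\<close>

section \<open>Rounding of times to a grid\<close>

text \<open>The passage through \<open>nat\<close> does two things: negative arguments are sent to
  0, so a rounded time is always a legitimate time of a process, and the value is a function of a
  countable index, on which the measurability of \<open>W\<close> at a rounded random time
  rests.\<close>

definition ceil_grid :: "nat \<Rightarrow> real \<Rightarrow> real" where
  "ceil_grid k x = real (nat \<lceil>real (Suc k) * x\<rceil>) / real (Suc k)"

lemma ceil_grid_nonneg: "0 \<le> ceil_grid k x"
  by (simp add: ceil_grid_def)

lemma ceil_grid_borel [measurable]: "ceil_grid k \<in> borel_measurable borel"
  unfolding ceil_grid_def by measurable

lemma ceil_grid_error:
  assumes "0 \<le> x"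
  shows "\<bar>ceil_grid k x - x\<bar> \<le> 1 / real (Suc k)"
proof -
  have "0 \<le> \<lceil>real (Suc k) * x\<rceil>"
    using assms by (metis ceiling_mono ceiling_zero mult_nonneg_nonneg of_nat_0_le_iff)
  then have "real (nat \<lceil>real (Suc k) * x\<rceil>) = of_int \<lceil>real (Suc k) * x\<rceil>"
    by simp
  then have "\<bar>real (nat \<lceil>real (Suc k) * x\<rceil>) - real (Suc k) * x\<bar> \<le> 1"
    by linarith
  moreover have "ceil_grid k x - x = (real (nat \<lceil>real (Suc k) * x\<rceil>) - real (Suc k) * x) / real (Suc k)"
    by (simp add: ceil_grid_def field_simps)
  ultimately show ?thesis
    by (simp add: divide_right_mono del: of_nat_Suc)
qed

lemma ceil_grid_tendsto:
  assumes "0 \<le> x"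
  shows "(\<lambda>k. ceil_grid k x) \<longlonglongrightarrow> x"
proof -
  have "(\<lambda>k. ceil_grid k x - x) \<longlonglongrightarrow> 0"
    by (rule Lim_null_comparison[OF _ lim_1_over_n[THEN LIMSEQ_Suc]])
       (use ceil_grid_error[OF assms] in auto)
  then show ?thesis
    by (simp add: LIM_zero_iff)
qed

section \<open>Convergence of second moments from an L2 rate\<close>

text \<open>Young's inequality for the cross term of y^2 - x^2 = 2 x (y - x) + (y - x)^2; it comes
  from the square of \<open>c * \<bar>x\<bar> - \<bar>y - x\<bar>\<close> divided by
  \<open>c\<close>. The weight \<open>c\<close> stays free so that it can be matched to the size of
  y - x.\<close>

lemma square_minus_square_le:
  fixes x y c :: real
  assumes "0 < c"
  shows "\<bar>y\<^sup>2 - x\<^sup>2\<bar> \<le> c * x\<^sup>2 + (1 / c + 1) * (y - x)\<^sup>2"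
proof -
  have "y\<^sup>2 - x\<^sup>2 = 2 * x * (y - x) + (y - x)\<^sup>2"
    by (simp add: power2_eq_square algebra_simps)
  moreover have "(c * \<bar>x\<bar> - \<bar>y - x\<bar>)\<^sup>2 / c = c * x\<^sup>2 + 1 / c * (y - x)\<^sup>2 - 2 * \<bar>x\<bar> * \<bar>y - x\<bar>"
    unfolding power2_diff power_mult_distrib power2_abs
    using assms by (simp add: field_simps power2_eq_square)
  moreover have "0 \<le> (c * \<bar>x\<bar> - \<bar>y - x\<bar>)\<^sup>2 / c"
    using assms by simp
  ultimately have "y\<^sup>2 - x\<^sup>2 = 2 * x * (y - x) + (y - x)\<^sup>2"
    and "\<bar>2 * x * (y - x)\<bar> \<le> c * x\<^sup>2 + 1 / c * (y - x)\<^sup>2"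
    by (simp_all add: abs_mult)
  then show ?thesis
    unfolding distrib_right using zero_le_power2[of "y - x"] by linarith
qed

text \<open>The difference of the second moments of \<open>g k\<close> and \<open>f\<close> is
  bounded by a small multiple of the second moment of \<open>f\<close> plus a large multiple of the
  L2 error. With a weight tending to 0 slowly enough both terms vanish, and uniqueness of limits
  identifies \<open>L\<close>.\<close>

lemma L2_limit_second_moment:
  fixes f :: "'a \<Rightarrow> real" and g :: "nat \<Rightarrow> 'a \<Rightarrow> real"
  assumes [measurable]: "f \<in> borel_measurable M" "\<And>k. g k \<in> borel_measurable M"
    and g: "\<And>k. integrable M (\<lambda>\<omega>. (g k \<omega>)\<^sup>2)"
    and d: "\<And>k. integrable M (\<lambda>\<omega>. (g k \<omega> - f \<omega>)\<^sup>2)"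
    and d_le: "\<And>k. (\<integral>\<omega>. (g k \<omega> - f \<omega>)\<^sup>2 \<partial>M) \<le> C / real (Suc k)"
    and lim: "(\<lambda>k. \<integral>\<omega>. (g k \<omega>)\<^sup>2 \<partial>M) \<longlonglongrightarrow> L"
  shows "has_bochner_integral M (\<lambda>\<omega>. (f \<omega>)\<^sup>2) L"
proof -
  have f: "integrable M (\<lambda>\<omega>. (f \<omega>)\<^sup>2)"
  proof (rule Bochner_Integration.integrable_bound)
    show "integrable M (\<lambda>\<omega>. 2 * (g 0 \<omega>)\<^sup>2 + 2 * (g 0 \<omega> - f \<omega>)\<^sup>2)"
      using g d by simp
    \<comment> \<open>The right side minus the left side is exactly the square of
      \<open>2 * g 0 \<omega> - f \<omega>\<close>.\<close>
    have "(f \<omega>)\<^sup>2 \<le> 2 * (g 0 \<omega>)\<^sup>2 + 2 * (g 0 \<omega> - f \<omega>)\<^sup>2" for \<omega>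
      using zero_le_power2[of "2 * g 0 \<omega> - f \<omega>"] by (simp add: power2_eq_square algebra_simps)
    then show "AE \<omega> in M. norm ((f \<omega>)\<^sup>2) \<le> norm (2 * (g 0 \<omega>)\<^sup>2 + 2 * (g 0 \<omega> - f \<omega>)\<^sup>2)"
      by simp
  qed measurable
  define S where "S = (\<integral>\<omega>. (f \<omega>)\<^sup>2 \<partial>M)"
  have bound: "\<bar>(\<integral>\<omega>. (g k \<omega>)\<^sup>2 \<partial>M) - S\<bar>
      \<le> 1 / sqrt (real (Suc k)) * S + (sqrt (real (Suc k)) + 1) * (C / real (Suc k))" for k
  proof -
    \<comment> \<open>This weight balances the two terms: \<open>c * S\<close> and
      \<open>1 / c * (C / real (Suc k))\<close> are both of order
      \<open>1 / sqrt (real (Suc k))\<close>.\<close>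
    define c where "c = 1 / sqrt (real (Suc k))"
    have c: "0 < c" by (simp add: c_def)
    have "\<bar>(\<integral>\<omega>. (g k \<omega>)\<^sup>2 \<partial>M) - S\<bar> = \<bar>\<integral>\<omega>. (g k \<omega>)\<^sup>2 - (f \<omega>)\<^sup>2 \<partial>M\<bar>"
      using f g by (simp add: S_def)
    also have "\<dots> \<le> (\<integral>\<omega>. \<bar>(g k \<omega>)\<^sup>2 - (f \<omega>)\<^sup>2\<bar> \<partial>M)"
      by (rule integral_abs_bound)
    also have "\<dots> \<le> (\<integral>\<omega>. c * (f \<omega>)\<^sup>2 + (1 / c + 1) * (g k \<omega> - f \<omega>)\<^sup>2 \<partial>M)"
      using f g d square_minus_square_le[OF c] by (intro integral_mono) auto
    also have "\<dots> = c * S + (1 / c + 1) * (\<integral>\<omega>. (g k \<omega> - f \<omega>)\<^sup>2 \<partial>M)"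
      using f d by (simp add: S_def)
    also have "\<dots> \<le> c * S + (1 / c + 1) * (C / real (Suc k))"
      using c d_le[of k] by (intro add_left_mono mult_left_mono) auto
    finally show ?thesis by (simp add: c_def del: of_nat_Suc)
  qed
  have "(\<lambda>k. 1 / sqrt (real (Suc k)) * S + (sqrt (real (Suc k)) + 1) * (C / real (Suc k))) \<longlonglongrightarrow> 0"
    by real_asymp
  then have "(\<lambda>k. (\<integral>\<omega>. (g k \<omega>)\<^sup>2 \<partial>M) - S) \<longlonglongrightarrow> 0"
    by (rule Lim_null_comparison[rotated]) (use bound in auto)
  then have "(\<lambda>k. \<integral>\<omega>. (g k \<omega>)\<^sup>2 \<partial>M) \<longlonglongrightarrow> S"
    by (simp add: LIM_zero_iff)
  with lim have "L = S" by (rule LIMSEQ_unique)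
  with f show ?thesis
    by (simp add: has_bochner_integral_iff S_def)
qed

lemma coordinate_measurable:
  "0 \<le> t \<Longrightarrow> (\<lambda>x. x t) \<in> borel_measurable (\<Pi>\<^sub>M t\<in>{0..}. borel :: real measure)"
  for t :: real
  by (rule measurable_component_singleton) simp

context prob_space
begin

section \<open>Consequences of independence on path space\<close>

lemma indep_processes_indep_increments:
  assumes "indep_processes X Y" "0 \<le> s" "0 \<le> t"
  shows "indep_var borel (\<lambda>\<omega>. X t \<omega> - X s \<omega>) borel (\<lambda>\<omega>. Y t \<omega> - Y s \<omega>)"
proof -
  note [measurable] = coordinate_measurable[OF assms(2)] coordinate_measurable[OF assms(3)]
  have "indep_var borel ((\<lambda>x. x t - x s) \<circ> (\<lambda>\<omega>. \<lambda>t\<in>{0..}. X t \<omega>))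
                  borel ((\<lambda>x. x t - x s) \<circ> (\<lambda>\<omega>. \<lambda>t\<in>{0..}. Y t \<omega>))"
    using assms(1) unfolding indep_processes_def by (rule indep_var_compose) measurable
  then show ?thesis
    using assms by (simp add: comp_def)
qed

lemma indep_processes_measurable:
  assumes "indep_processes X Y" "0 \<le> t"
  shows "X t \<in> borel_measurable M" "Y t \<in> borel_measurable M"
proof -
  note rv = assms(1)[unfolded indep_processes_def, THEN indep_var_rv1]
    assms(1)[unfolded indep_processes_def, THEN indep_var_rv2]
  show "X t \<in> borel_measurable M" "Y t \<in> borel_measurable M"
    using measurable_compose[OF rv(1) coordinate_measurable[OF assms(2)]]
      measurable_compose[OF rv(2) coordinate_measurable[OF assms(2)]] assms(2) by simp_all
qed

section \<open>Second moments of the time-changed Brownian motion\<close>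

text \<open>The form with \<open>ennreal\<close> and an absolute value fits Tonelli's theorem, where
  the two times are values of the clock in no known order. Equal times form a case of their own,
  since \<open>brownian_motion\<close> prescribes a normal law only for
  \<open>s < t\<close>.\<close>

lemma brownian_increment_nn_second_moment:
  assumes "brownian_motion W" "0 \<le> x" "0 \<le> y"
  shows "(\<integral>\<^sup>+\<omega>. ennreal ((W x \<omega> - W y \<omega>)\<^sup>2) \<partial>M) = ennreal \<bar>x - y\<bar>"
proof -
  have less: "(\<integral>\<^sup>+\<omega>. ennreal ((W b \<omega> - W a \<omega>)\<^sup>2) \<partial>M) = ennreal (b - a)" if "0 \<le> a" "a < b" for a b
  proof -
    let ?s = "sqrt (b - a)"
    have D: "distributed M lborel (\<lambda>\<omega>. W b \<omega> - W a \<omega>) (normal_density 0 ?s)"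
      using assms(1) that by (simp add: brownian_motion_def)
    have "(\<integral>\<^sup>+\<omega>. ennreal ((W b \<omega> - W a \<omega>)\<^sup>2) \<partial>M)
        = (\<integral>\<^sup>+z. ennreal (normal_density 0 ?s z) * ennreal (z\<^sup>2) \<partial>lborel)"
      by (rule distributed_nn_integral[OF D, symmetric]) simp
    \<comment> \<open>The integrand takes the shape of the even normal moments, whose first instance
      evaluates to \<open>2 / (2 / ?s\<^sup>2)\<close>, that is, to the variance.\<close>
    also have "\<dots> = (\<integral>\<^sup>+z. ennreal (normal_density 0 ?s z * (z - 0) ^ (2 * 1)) \<partial>lborel)"
      by (simp add: ennreal_mult)
    also have "\<dots> = ennreal (fact (2 * 1) / ((2 / ?s\<^sup>2) ^ 1 * fact 1))"
      using that by (intro nn_integral_eq_integrable[THEN iffD2] conjI)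
        (use normal_moment_even[of ?s 0 1] in \<open>auto simp: has_bochner_integral_iff\<close>)
    also have "\<dots> = ennreal (b - a)"
      using that by simp
    finally show ?thesis .
  qed
  consider "x = y" | "y < x" | "x < y" by linarith
  then show ?thesis
  proof cases
    case 3
    then show ?thesis
      using less[of x y] assms by (simp add: power2_commute)
  qed (use less[of y x] assms in simp_all)
qed

text \<open>Independence makes the joint law of the two paths a product. With the path of \<tau>
  frozen, both times are deterministic and the Brownian second moment applies. Two levels and two
  times are allowed because the lemma has two uses: equal times with different levels for the
  rounding error, and equal levels with different times for the increment.\<close>

lemma ceil_grid_brownian_nn_second_moment:
  assumes W: "brownian_motion W" and ind: "indep_processes W \<tau>" and t: "0 \<le> t" "0 \<le> s"
  shows "(\<integral>\<^sup>+\<omega>. ennreal ((W (ceil_grid k (\<tau> t \<omega>)) \<omega> - W (ceil_grid m (\<tau> s \<omega>)) \<omega>)\<^sup>2) \<partial>M)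
       = (\<integral>\<^sup>+\<omega>. ennreal \<bar>ceil_grid k (\<tau> t \<omega>) - ceil_grid m (\<tau> s \<omega>)\<bar> \<partial>M)"
proof -
  let ?P = "\<Pi>\<^sub>M t\<in>{0::real..}. borel :: real measure"
  define w where "w = (\<lambda>\<omega>. \<lambda>t\<in>{0..}. W t \<omega>)"
  define a where "a = (\<lambda>\<omega>. \<lambda>t\<in>{0..}. \<tau> t \<omega>)"
  have iv: "indep_var ?P w ?P a"
    using ind by (simp add: indep_processes_def w_def a_def)
  have [measurable]: "w \<in> measurable M ?P" "a \<in> measurable M ?P"
    using iv by (auto dest: indep_var_rv1 indep_var_rv2)
  have joint: "distr M (?P \<Otimes>\<^sub>M ?P) (\<lambda>\<omega>. (w \<omega>, a \<omega>)) = distr M ?P w \<Otimes>\<^sub>M distr M ?P a"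
    using iv by (simp add: indep_var_distribution_eq)
  interpret A: prob_space "distr M ?P a" by (rule prob_space_distr) measurable
  interpret B: prob_space "distr M ?P w" by (rule prob_space_distr) measurable
  interpret AB: pair_sigma_finite "distr M ?P w" "distr M ?P a" ..
  \<comment> \<open>A rounded time takes countably many values, so this evaluation is glued from
    evaluations at fixed times along a measurable index.\<close>
  have ev [measurable]: "(\<lambda>p. fst p (ceil_grid k (snd p t))) \<in> borel_measurable (?P \<Otimes>\<^sub>M ?P)"
    if "0 \<le> t" for k t
  proof -
    note [measurable] = coordinate_measurable[OF that]
    have f: "(\<lambda>p. fst p (real i / real (Suc k))) \<in> borel_measurable (?P \<Otimes>\<^sub>M ?P)" for i :: nat
    proof -
      have [measurable]: "(\<lambda>x. x (real i / real (Suc k))) \<in> borel_measurable ?P"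
        by (rule coordinate_measurable) simp
      show ?thesis by measurable
    qed
    have g: "(\<lambda>p. nat \<lceil>real (Suc k) * snd p t\<rceil>) \<in> measurable (?P \<Otimes>\<^sub>M ?P) (count_space UNIV)"
      by measurable
    show ?thesis
      unfolding ceil_grid_def using measurable_compose_countable[OF f g] .
  qed
  define F where "F = (\<lambda>p :: (real \<Rightarrow> real) \<times> (real \<Rightarrow> real).
    ennreal ((fst p (ceil_grid k (snd p t)) - fst p (ceil_grid m (snd p s)))\<^sup>2))"
  have [measurable]: "F \<in> borel_measurable (?P \<Otimes>\<^sub>M ?P)"
    unfolding F_def using ev[of t k] ev[of s m] t by measurable
  have F': "F \<in> borel_measurable (distr M ?P w \<Otimes>\<^sub>M distr M ?P a)"
    by measurable
  note [measurable] = coordinate_measurable[OF t(1)] coordinate_measurable[OF t(2)]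
  \<comment> \<open>The restrictions in \<open>w\<close> and \<open>a\<close> are invisible here, as
    the paths are read at nonnegative times only.\<close>
  have "(\<integral>\<^sup>+\<omega>. ennreal ((W (ceil_grid k (\<tau> t \<omega>)) \<omega> - W (ceil_grid m (\<tau> s \<omega>)) \<omega>)\<^sup>2) \<partial>M)
      = (\<integral>\<^sup>+\<omega>. F (w \<omega>, a \<omega>) \<partial>M)"
    using t by (simp add: F_def w_def a_def ceil_grid_nonneg)
  also have "\<dots> = (\<integral>\<^sup>+p. F p \<partial>distr M (?P \<Otimes>\<^sub>M ?P) (\<lambda>\<omega>. (w \<omega>, a \<omega>)))"
    by (subst nn_integral_distr) measurable
  \<comment> \<open>Tonelli, with the Brownian path as the inner variable and the clock path
    \<open>y\<close> outside.\<close>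
  also have "\<dots> = (\<integral>\<^sup>+y. \<integral>\<^sup>+x. F (x, y) \<partial>distr M ?P w \<partial>distr M ?P a)"
    unfolding joint by (rule AB.nn_integral_snd[OF F', symmetric])
  also have "\<dots> = (\<integral>\<^sup>+y. ennreal \<bar>ceil_grid k (y t) - ceil_grid m (y s)\<bar> \<partial>distr M ?P a)"
  proof (rule nn_integral_cong)
    fix y assume "y \<in> space (distr M ?P a)"
    then have y: "y \<in> space ?P" by simp
    have "(\<integral>\<^sup>+x. F (x, y) \<partial>distr M ?P w) = (\<integral>\<^sup>+\<omega>. F (w \<omega>, y) \<partial>M)"
      using y by (subst nn_integral_distr) measurable
    also have "\<dots> = (\<integral>\<^sup>+\<omega>. ennreal ((W (ceil_grid k (y t)) \<omega> - W (ceil_grid m (y s)) \<omega>)\<^sup>2) \<partial>M)"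
      by (simp add: F_def w_def ceil_grid_nonneg)
    also have "\<dots> = ennreal \<bar>ceil_grid k (y t) - ceil_grid m (y s)\<bar>"
      by (rule brownian_increment_nn_second_moment[OF W ceil_grid_nonneg ceil_grid_nonneg])
    finally show "(\<integral>\<^sup>+x. F (x, y) \<partial>distr M ?P w) = ennreal \<bar>ceil_grid k (y t) - ceil_grid m (y s)\<bar>" .
  qed
  also have "\<dots> = (\<integral>\<^sup>+\<omega>. ennreal \<bar>ceil_grid k (\<tau> t \<omega>) - ceil_grid m (\<tau> s \<omega>)\<bar> \<partial>M)"
    using t by (subst nn_integral_distr) (measurable, simp add: a_def)
  finally show ?thesis .
qed

lemma ceil_grid_brownian_measurable:
  assumes "indep_processes W \<tau>" "0 \<le> t"
  shows "(\<lambda>\<omega>. W (ceil_grid k (\<tau> t \<omega>)) \<omega>) \<in> borel_measurable M"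
proof -
  note [measurable] = indep_processes_measurable(2)[OF assms]
  have "W (real i / real (Suc k)) \<in> borel_measurable M" for i :: nat
    by (rule indep_processes_measurable(1)[OF assms(1)]) simp
  then show ?thesis
    unfolding ceil_grid_def
    by (rule measurable_compose_countable[where f="\<lambda>i. W (real i / real (Suc k))"]) measurable
qed

lemma integral_le_of_nn_integral_le:
  assumes "f \<in> borel_measurable M" "\<And>\<omega>. 0 \<le> f \<omega>" "(\<integral>\<^sup>+\<omega>. ennreal (f \<omega>) \<partial>M) \<le> ennreal c" "0 \<le> c"
  shows "integrable M f" "(\<integral>\<omega>. f \<omega> \<partial>M) \<le> c"
proof -
  show f: "integrable M f"
    using assms by (intro integrableI_nonneg) (auto intro: le_less_trans)
  show "(\<integral>\<omega>. f \<omega> \<partial>M) \<le> c"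
    using assms(3,4) nn_integral_eq_integral[OF f] assms(2) by (simp add: ennreal_le_iff)
qed

text \<open>Start at 0 and monotonicity are almost sure properties, so the pathwise estimates on the
  clock below hold only under \<open>AE\<close>.\<close>

lemma subordinator_AE_nonneg:
  assumes "subordinator \<tau>" "0 \<le> t"
  shows "AE \<omega> in M. 0 \<le> \<tau> t \<omega>"
proof -
  have "AE \<omega> in M. \<tau> 0 \<omega> = 0" "AE \<omega> in M. mono_on {0..} (\<lambda>t. \<tau> t \<omega>)"
    using assms(1) by (auto simp: subordinator_def levy_process_def)
  then show ?thesis
  proof eventually_elim
    case (elim \<omega>)
    then show ?case using mono_onD[OF elim(2), of 0 t] assms(2) by simp
  qed
qed

text \<open>The exact time \<tau> t is approached by a second rounding at level \<open>m\<close>.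
  Path continuity turns the error into a limit in \<open>m\<close>, and Fatou's lemma bounds it by
  the errors between levels \<open>k\<close> and \<open>m\<close>, which are known. Measurability of
  \<open>W\<close> at the exact clock time is assumed; the theorem supplies it from the process
  \<open>X\<close>.\<close>

lemma ceil_grid_brownian_L2_error:
  assumes W: "brownian_motion W" and sub: "subordinator \<tau>" and ind: "indep_processes W \<tau>"
    and t: "0 \<le> t" and [measurable]: "(\<lambda>\<omega>. W (\<tau> t \<omega>) \<omega>) \<in> borel_measurable M"
  shows "integrable M (\<lambda>\<omega>. (W (ceil_grid k (\<tau> t \<omega>)) \<omega> - W (\<tau> t \<omega>) \<omega>)\<^sup>2)" (is ?int)
    and "(\<integral>\<omega>. (W (ceil_grid k (\<tau> t \<omega>)) \<omega> - W (\<tau> t \<omega>) \<omega>)\<^sup>2 \<partial>M) \<le> 1 / real (Suc k)" (is ?le)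
proof -
  note [measurable] = ceil_grid_brownian_measurable[OF ind t]
  have cont: "AE \<omega> in M. continuous_on {0..} (\<lambda>t. W t \<omega>)"
    using W by (simp add: brownian_motion_def)
  define u where "u = (\<lambda>m \<omega>. ennreal ((W (ceil_grid k (\<tau> t \<omega>)) \<omega> - W (ceil_grid m (\<tau> t \<omega>)) \<omega>)\<^sup>2))"
  have [measurable]: "u m \<in> borel_measurable M" for m
    unfolding u_def by measurable
  have "(\<integral>\<^sup>+\<omega>. ennreal ((W (ceil_grid k (\<tau> t \<omega>)) \<omega> - W (\<tau> t \<omega>) \<omega>)\<^sup>2) \<partial>M)
      = (\<integral>\<^sup>+\<omega>. liminf (\<lambda>m. u m \<omega>) \<partial>M)"
  proof (rule nn_integral_cong_AE)
    show "AE \<omega> in M. ennreal ((W (ceil_grid k (\<tau> t \<omega>)) \<omega> - W (\<tau> t \<omega>) \<omega>)\<^sup>2) = liminf (\<lambda>m. u m \<omega>)"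
      using cont subordinator_AE_nonneg[OF sub t]
    proof eventually_elim
      case (elim \<omega>)
      \<comment> \<open>Continuity on \<open>{0..}\<close> is enough, since the rounded times and
        their limit all stay in that set.\<close>
      have "(\<lambda>m. W (ceil_grid m (\<tau> t \<omega>)) \<omega>) \<longlonglongrightarrow> W (\<tau> t \<omega>) \<omega>"
        using elim by (intro continuous_on_tendsto_compose[OF elim(1)] ceil_grid_tendsto)
          (auto simp: ceil_grid_nonneg)
      then have "(\<lambda>m. u m \<omega>) \<longlonglongrightarrow> ennreal ((W (ceil_grid k (\<tau> t \<omega>)) \<omega> - W (\<tau> t \<omega>) \<omega>)\<^sup>2)"
        unfolding u_def by (intro tendsto_ennrealI tendsto_intros)
      then show ?case
        by (simp add: lim_imp_Liminf)
    qed
  qed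
  also have "\<dots> \<le> liminf (\<lambda>m. \<integral>\<^sup>+\<omega>. u m \<omega> \<partial>M)"
    by (rule nn_integral_liminf) measurable
  also have "\<dots> \<le> liminf (\<lambda>m. ennreal (1 / real (Suc k) + 1 / real (Suc m)))"
  proof (rule Liminf_mono, rule always_eventually, rule allI)
    fix m
    have "(\<integral>\<^sup>+\<omega>. u m \<omega> \<partial>M) = (\<integral>\<^sup>+\<omega>. ennreal \<bar>ceil_grid k (\<tau> t \<omega>) - ceil_grid m (\<tau> t \<omega>)\<bar> \<partial>M)"
      unfolding u_def by (rule ceil_grid_brownian_nn_second_moment[OF W ind t t])
    \<comment> \<open>Both roundings are close to the same clock value, so the triangle inequality
      adds their errors.\<close>
    also have "\<dots> \<le> (\<integral>\<^sup>+\<omega>. ennreal (1 / real (Suc k) + 1 / real (Suc m)) \<partial>M)"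
    proof (rule nn_integral_mono_AE)
      show "AE \<omega> in M. ennreal \<bar>ceil_grid k (\<tau> t \<omega>) - ceil_grid m (\<tau> t \<omega>)\<bar>
          \<le> ennreal (1 / real (Suc k) + 1 / real (Suc m))"
        using subordinator_AE_nonneg[OF sub t]
      proof eventually_elim
        case (elim \<omega>)
        show ?case
          using ceil_grid_error[OF elim, of k] ceil_grid_error[OF elim, of m]
          by (intro ennreal_leI) linarith
      qed
    qed
    finally show "(\<integral>\<^sup>+\<omega>. u m \<omega> \<partial>M) \<le> ennreal (1 / real (Suc k) + 1 / real (Suc m))"
      by (simp add: emeasure_space_1)
  qed
  also have "\<dots> = ennreal (1 / real (Suc k))"
  proof (rule lim_imp_Liminf)
    have "(\<lambda>m. 1 / real (Suc k) + 1 / real (Suc m)) \<longlonglongrightarrow> 1 / real (Suc k)"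
      by real_asymp
    then show "(\<lambda>m. ennreal (1 / real (Suc k) + 1 / real (Suc m))) \<longlonglongrightarrow> ennreal (1 / real (Suc k))"
      by (rule tendsto_ennrealI)
  qed simp
  finally have le: "(\<integral>\<^sup>+\<omega>. ennreal ((W (ceil_grid k (\<tau> t \<omega>)) \<omega> - W (\<tau> t \<omega>) \<omega>)\<^sup>2) \<partial>M)
      \<le> ennreal (1 / real (Suc k))" .
  show ?int ?le
    using integral_le_of_nn_integral_le[OF _ _ le] by auto
qed

text \<open>For rounded times the second moment is the mean rounded clock increment. Its limit is
  the mean of \<tau> t - \<tau> s, which is \<open>t - s\<close>, and the L2 rate of the rounding
  error carries this over to the exact times.\<close>

lemma time_changed_brownian_second_moment:
  assumes W: "brownian_motion W" and sub: "subordinator \<tau>" and ind: "indep_processes W \<tau>"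
    and mean: "\<And>t. 0 \<le> t \<Longrightarrow> has_bochner_integral M (\<tau> t) t"
    and s: "0 \<le> s" and st: "s \<le> t"
    and meas: "\<And>t. 0 \<le> t \<Longrightarrow> (\<lambda>\<omega>. W (\<tau> t \<omega>) \<omega>) \<in> borel_measurable M"
  shows "has_bochner_integral M (\<lambda>\<omega>. (W (\<tau> t \<omega>) \<omega> - W (\<tau> s \<omega>) \<omega>)\<^sup>2) (t - s)"
proof -
  have t: "0 \<le> t" using s st by simp
  note [measurable] = meas[OF s] meas[OF t] indep_processes_measurable(2)[OF ind t]
    indep_processes_measurable(2)[OF ind s]
    ceil_grid_brownian_measurable[OF ind t] ceil_grid_brownian_measurable[OF ind s]
  note err = ceil_grid_brownian_L2_error[OF W sub ind]
  note ints = integrable.intros[OF mean[OF t]] integrable.intros[OF mean[OF s]]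
  have mono: "AE \<omega> in M. 0 \<le> \<tau> s \<omega> \<and> 0 \<le> \<tau> t \<omega> \<and> \<tau> s \<omega> \<le> \<tau> t \<omega>"
  proof -
    have "AE \<omega> in M. mono_on {0..} (\<lambda>t. \<tau> t \<omega>)"
      using sub by (simp add: subordinator_def)
    with subordinator_AE_nonneg[OF sub s] subordinator_AE_nonneg[OF sub t] show ?thesis
    proof eventually_elim
      case (elim \<omega>)
      then show ?case using mono_onD[OF elim(3), of s t] s st by simp
    qed
  qed
  define g where "g = (\<lambda>k \<omega>. W (ceil_grid k (\<tau> t \<omega>)) \<omega> - W (ceil_grid k (\<tau> s \<omega>)) \<omega>)"
  define f where "f = (\<lambda>\<omega>. W (\<tau> t \<omega>) \<omega> - W (\<tau> s \<omega>) \<omega>)"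
  define v where "v = (\<lambda>k \<omega>. \<bar>ceil_grid k (\<tau> t \<omega>) - ceil_grid k (\<tau> s \<omega>)\<bar>)"
  have [measurable]: "g k \<in> borel_measurable M" "f \<in> borel_measurable M" "v k \<in> borel_measurable M" for k
    unfolding g_def f_def v_def by measurable
  \<comment> \<open>One rounding error for each of the two times; monotonicity of \<tau> makes the
    unrounded increment nonnegative, which disposes of the absolute value in
    \<open>v\<close>.\<close>
  have v_close: "AE \<omega> in M. \<bar>v k \<omega> - (\<tau> t \<omega> - \<tau> s \<omega>)\<bar> \<le> 2 / real (Suc k)" for k
    using mono
  proof eventually_elim
    case (elim \<omega>)
    have "2 / real (Suc k) = 1 / real (Suc k) + 1 / real (Suc k)" by simp
    with elim show ?case
      using ceil_grid_error[of "\<tau> t \<omega>" k] ceil_grid_error[of "\<tau> s \<omega>" k]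
      unfolding v_def by linarith
  qed
  have v_int: "integrable M (v k)" for k
  proof (rule Bochner_Integration.integrable_bound)
    show "integrable M (\<lambda>\<omega>. \<bar>\<tau> t \<omega> - \<tau> s \<omega>\<bar> + 2 / real (Suc k))"
      using ints by (auto simp: has_bochner_integral_iff)
    show "AE \<omega> in M. norm (v k \<omega>) \<le> norm (\<bar>\<tau> t \<omega> - \<tau> s \<omega>\<bar> + 2 / real (Suc k))"
      using v_close[of k] by eventually_elim simp
  qed measurable
  have v_lim: "(\<lambda>k. \<integral>\<omega>. v k \<omega> \<partial>M) \<longlonglongrightarrow> t - s"
  proof -
    have bound: "norm ((\<integral>\<omega>. v k \<omega> \<partial>M) - (t - s)) \<le> 2 / real (Suc k)" for k
    proof -
      have "\<bar>(\<integral>\<omega>. v k \<omega> \<partial>M) - (t - s)\<bar> = \<bar>\<integral>\<omega>. v k \<omega> - (\<tau> t \<omega> - \<tau> s \<omega>) \<partial>M\<bar>"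
        using v_int ints mean[OF t] mean[OF s] by (simp add: has_bochner_integral_iff)
      also have "\<dots> \<le> (\<integral>\<omega>. \<bar>v k \<omega> - (\<tau> t \<omega> - \<tau> s \<omega>)\<bar> \<partial>M)"
        by (rule integral_abs_bound)
      also have "\<dots> \<le> (\<integral>\<omega>. 2 / real (Suc k) \<partial>M)"
        using v_int ints v_close by (intro integral_mono_AE) auto
      finally show ?thesis by (simp add: prob_space)
    qed
    have "(\<lambda>k. 2 / real (Suc k)) \<longlonglongrightarrow> 0" by real_asymp
    then have "(\<lambda>k. (\<integral>\<omega>. v k \<omega> \<partial>M) - (t - s)) \<longlonglongrightarrow> 0"
      by (rule Lim_null_comparison[OF always_eventually[OF allI[OF bound]]])
    then show ?thesis by (simp add: LIM_zero_iff)
  qed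
  have g: "has_bochner_integral M (\<lambda>\<omega>. (g k \<omega>)\<^sup>2) (\<integral>\<omega>. v k \<omega> \<partial>M)" for k
  proof (rule has_bochner_integral_nn_integral)
    have "(\<integral>\<^sup>+\<omega>. ennreal ((g k \<omega>)\<^sup>2) \<partial>M) = (\<integral>\<^sup>+\<omega>. ennreal (v k \<omega>) \<partial>M)"
      unfolding g_def v_def by (rule ceil_grid_brownian_nn_second_moment[OF W ind t s])
    also have "\<dots> = ennreal (\<integral>\<omega>. v k \<omega> \<partial>M)"
      by (rule nn_integral_eq_integral[OF v_int]) (simp add: v_def)
    finally show "(\<integral>\<^sup>+\<omega>. ennreal ((g k \<omega>)\<^sup>2) \<partial>M) = ennreal (\<integral>\<omega>. v k \<omega> \<partial>M)" .
  qed (auto simp: v_def)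
  have diff_le: "(g k \<omega> - f \<omega>)\<^sup>2 \<le> 2 * (W (ceil_grid k (\<tau> t \<omega>)) \<omega> - W (\<tau> t \<omega>) \<omega>)\<^sup>2
      + 2 * (W (ceil_grid k (\<tau> s \<omega>)) \<omega> - W (\<tau> s \<omega>) \<omega>)\<^sup>2" for k \<omega>
  proof -
    have "(a - b)\<^sup>2 \<le> 2 * a\<^sup>2 + 2 * b\<^sup>2" for a b :: real
      using zero_le_power2[of "a + b"] by (simp add: power2_eq_square algebra_simps)
    from this[of "W (ceil_grid k (\<tau> t \<omega>)) \<omega> - W (\<tau> t \<omega>) \<omega>" "W (ceil_grid k (\<tau> s \<omega>)) \<omega> - W (\<tau> s \<omega>) \<omega>"]
    show ?thesis by (simp add: g_def f_def algebra_simps)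
  qed
  have major: "integrable M (\<lambda>\<omega>. 2 * (W (ceil_grid k (\<tau> t \<omega>)) \<omega> - W (\<tau> t \<omega>) \<omega>)\<^sup>2
      + 2 * (W (ceil_grid k (\<tau> s \<omega>)) \<omega> - W (\<tau> s \<omega>) \<omega>)\<^sup>2)" for k
    using err(1)[OF t meas[OF t]] err(1)[OF s meas[OF s]] by simp
  have d: "integrable M (\<lambda>\<omega>. (g k \<omega> - f \<omega>)\<^sup>2)" for k
    by (rule Bochner_Integration.integrable_bound[OF major[of k]]) (use diff_le in \<open>auto simp: abs_of_nonneg\<close>)
  have "has_bochner_integral M (\<lambda>\<omega>. (f \<omega>)\<^sup>2) (t - s)"
  \<comment> \<open>The constant 4 is twice the error 1 / (k + 1), from the bound 2 a^2 + 2 b^2 in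
    \<open>diff_le\<close>, for each of the two times.\<close>
  proof (rule L2_limit_second_moment[where g=g and C=4])
    fix k
    have "(\<integral>\<omega>. (g k \<omega> - f \<omega>)\<^sup>2 \<partial>M) \<le> (\<integral>\<omega>. 2 * (W (ceil_grid k (\<tau> t \<omega>)) \<omega> - W (\<tau> t \<omega>) \<omega>)\<^sup>2
      + 2 * (W (ceil_grid k (\<tau> s \<omega>)) \<omega> - W (\<tau> s \<omega>) \<omega>)\<^sup>2 \<partial>M)"
      using diff_le by (intro integral_mono d major)
    also have "\<dots> \<le> 4 / real (Suc k)"
      using err[OF t meas[OF t], of k] err[OF s meas[OF s], of k] by simp
    finally show "(\<integral>\<omega>. (g k \<omega> - f \<omega>)\<^sup>2 \<partial>M) \<le> 4 / real (Suc k)" .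
  qed (use g d v_lim in \<open>auto simp: has_bochner_integral_iff\<close>)
  then show ?thesis by (simp add: f_def)
qed

section \<open>Increments of the noise and of the observed process\<close>

text \<open>An increment is a function of the joint law at two times, so stationarity is applied to
  the family \<open>{0, h}\<close> shifted by \<open>s\<close> and pushed forward along
  \<open>x h - x 0\<close>.\<close>

lemma stationary_increment_distr:
  assumes "stochastic_process \<epsilon>" "stationary_process \<epsilon>" and s: "0 \<le> s" and h: "0 \<le> h"
  shows "distr M borel (\<lambda>\<omega>. \<epsilon> (s + h) \<omega> - \<epsilon> s \<omega>) = distr M borel (\<lambda>\<omega>. \<epsilon> h \<omega> - \<epsilon> 0 \<omega>)"
proof -
  let ?J = "{0, h}"
  let ?P = "\<Pi>\<^sub>M t\<in>?J. borel :: real measure"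
  have J: "finite ?J" "?J \<subseteq> {0..}" using h by auto
  have eq: "distr M ?P (\<lambda>\<omega>. \<lambda>t\<in>?J. \<epsilon> (t + s) \<omega>) = distr M ?P (\<lambda>\<omega>. \<lambda>t\<in>?J. \<epsilon> t \<omega>)"
    using assms(2) s J unfolding stationary_process_def by blast
  have rv: "\<epsilon> t \<in> borel_measurable M" if "0 \<le> t" for t
    using assms(1) that by (simp add: stochastic_process_def)
  have diff: "(\<lambda>x. x h - x 0) \<in> borel_measurable ?P"
    by (intro borel_measurable_diff measurable_component_singleton) auto
  have m1: "(\<lambda>\<omega>. \<lambda>t\<in>?J. \<epsilon> (t + s) \<omega>) \<in> measurable M ?P"
    using s h by (intro measurable_restrict rv) auto
  have m2: "(\<lambda>\<omega>. \<lambda>t\<in>?J. \<epsilon> t \<omega>) \<in> measurable M ?P"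
    using h by (intro measurable_restrict rv) auto
  have "distr M borel (\<lambda>\<omega>. \<epsilon> (s + h) \<omega> - \<epsilon> s \<omega>)
      = distr (distr M ?P (\<lambda>\<omega>. \<lambda>t\<in>?J. \<epsilon> (t + s) \<omega>)) borel (\<lambda>x. x h - x 0)"
    by (simp add: distr_distr[OF diff m1] comp_def add.commute)
  also have "\<dots> = distr M borel (\<lambda>\<omega>. \<epsilon> h \<omega> - \<epsilon> 0 \<omega>)"
    by (simp add: eq distr_distr[OF diff m2] comp_def)
  finally show ?thesis .
qed

lemma noise_process_moments:
  assumes "noise_process \<epsilon>" "0 \<le> t"
  shows "integrable M (\<epsilon> t)" "integrable M (\<lambda>\<omega>. (\<epsilon> t \<omega>)\<^sup>2)" "expectation (\<epsilon> t) = 0"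
proof -
  have [measurable]: "\<epsilon> t \<in> borel_measurable M"
    using assms by (simp add: noise_process_def stochastic_process_def)
  have pow: "integrable M (\<lambda>\<omega>. \<bar>\<epsilon> t \<omega>\<bar> ^ k)" for k
    using assms by (simp add: noise_process_def)
  show "integrable M (\<epsilon> t)"
    using pow[of 1] by (simp add: integrable_abs_iff)
  show "integrable M (\<lambda>\<omega>. (\<epsilon> t \<omega>)\<^sup>2)"
    using pow[of 2] by simp
  show "expectation (\<epsilon> t) = 0"
    using assms by (simp add: noise_process_def)
qed

text \<open>In the expanded square the cross term has mean 0: the noise increment is centered and
  independent of the increment of \<open>X\<close>. Stationarity then moves the noise part to
  starting time 0.\<close>

lemma observed_increment_second_moment:
  assumes \<epsilon>: "noise_process \<epsilon>" and ind: "indep_processes \<epsilon> X" and s: "0 \<le> s" and h: "0 \<le> h"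
    and X: "has_bochner_integral M (\<lambda>\<omega>. (X (s + h) \<omega> - X s \<omega>)\<^sup>2) v"
  shows "has_bochner_integral M (\<lambda>\<omega>. ((X (s + h) \<omega> + \<epsilon> (s + h) \<omega>) - (X s \<omega> + \<epsilon> s \<omega>))\<^sup>2)
           (v + (\<integral>\<omega>. (\<epsilon> h \<omega> - \<epsilon> 0 \<omega>)\<^sup>2 \<partial>M))"
proof -
  have sh: "0 \<le> s + h" using s h by simp
  have proc: "stochastic_process \<epsilon>" "stationary_process \<epsilon>"
    using \<epsilon> by (simp_all add: noise_process_def)
  note [measurable] = indep_processes_measurable[OF ind s] indep_processes_measurable[OF ind sh]
    indep_processes_measurable(1)[OF ind h] indep_processes_measurable(1)[OF ind order_refl]
  define D where "D = (\<lambda>\<omega>. X (s + h) \<omega> - X s \<omega>)"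
  define E where "E = (\<lambda>\<omega>. \<epsilon> (s + h) \<omega> - \<epsilon> s \<omega>)"
  have [measurable]: "D \<in> borel_measurable M" "E \<in> borel_measurable M"
    unfolding D_def E_def by measurable
  have D2: "has_bochner_integral M (\<lambda>\<omega>. (D \<omega>)\<^sup>2) v"
    using X by (simp add: D_def)
  note moments = noise_process_moments[OF \<epsilon> s] noise_process_moments[OF \<epsilon> sh]
  have E1: "integrable M E" and E0: "expectation E = 0"
    unfolding E_def using moments by simp_all
  have E2: "integrable M (\<lambda>\<omega>. (E \<omega>)\<^sup>2)"
  proof (rule Bochner_Integration.integrable_bound)
    show "integrable M (\<lambda>\<omega>. 2 * (\<epsilon> (s + h) \<omega>)\<^sup>2 + 2 * (\<epsilon> s \<omega>)\<^sup>2)"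
      using moments by simp
    have "(E \<omega>)\<^sup>2 \<le> 2 * (\<epsilon> (s + h) \<omega>)\<^sup>2 + 2 * (\<epsilon> s \<omega>)\<^sup>2" for \<omega>
      using zero_le_power2[of "\<epsilon> (s + h) \<omega> + \<epsilon> s \<omega>"]
      by (simp add: E_def power2_eq_square algebra_simps)
    then show "AE \<omega> in M. norm ((E \<omega>)\<^sup>2) \<le> norm (2 * (\<epsilon> (s + h) \<omega>)\<^sup>2 + 2 * (\<epsilon> s \<omega>)\<^sup>2)"
      by simp
  qed measurable
  have "(\<integral>\<omega>. (E \<omega>)\<^sup>2 \<partial>M) = (\<integral>x. x\<^sup>2 \<partial>distr M borel E)"
    by (simp add: integral_distr)
  also have "\<dots> = (\<integral>x. x\<^sup>2 \<partial>distr M borel (\<lambda>\<omega>. \<epsilon> h \<omega> - \<epsilon> 0 \<omega>))"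
    unfolding E_def by (simp only: stationary_increment_distr[OF proc s h])
  also have "\<dots> = (\<integral>\<omega>. (\<epsilon> h \<omega> - \<epsilon> 0 \<omega>)\<^sup>2 \<partial>M)"
    by (simp add: integral_distr)
  finally have E2_eq: "(\<integral>\<omega>. (E \<omega>)\<^sup>2 \<partial>M) = (\<integral>\<omega>. (\<epsilon> h \<omega> - \<epsilon> 0 \<omega>)\<^sup>2 \<partial>M)" .
  have D1: "integrable M D"
    using square_integrable_imp_integrable[OF _ integrable.intros[OF D2]] by simp
  have iv: "indep_var borel E borel D"
    unfolding D_def E_def by (rule indep_processes_indep_increments[OF ind s sh])
  have cross: "has_bochner_integral M (\<lambda>\<omega>. E \<omega> * D \<omega>) 0"
    using indep_var_lebesgue_integral[OF iv E1 D1] indep_var_integrable[OF iv E1 D1] E0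
    by (simp add: has_bochner_integral_iff)
  have "has_bochner_integral M (\<lambda>\<omega>. (D \<omega>)\<^sup>2 + (E \<omega>)\<^sup>2 + 2 * (E \<omega> * D \<omega>))
      (v + (\<integral>\<omega>. (\<epsilon> h \<omega> - \<epsilon> 0 \<omega>)\<^sup>2 \<partial>M) + 2 * 0)"
    using D2 E2 E2_eq cross
    by (intro has_bochner_integral_add has_bochner_integral_mult_right) (auto simp: has_bochner_integral_iff)
  moreover have "(\<lambda>\<omega>. (D \<omega>)\<^sup>2 + (E \<omega>)\<^sup>2 + 2 * (E \<omega> * D \<omega>))
      = (\<lambda>\<omega>. ((X (s + h) \<omega> + \<epsilon> (s + h) \<omega>) - (X s \<omega> + \<epsilon> s \<omega>))\<^sup>2)"
    by (rule ext) (simp add: D_def E_def power2_eq_square algebra_simps)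
  ultimately show ?thesis by simp
qed

text \<open>The value is the same for every positive lag, which is what makes the noise
  contributions of the two scales cancel.\<close>

lemma white_noise_increment_second_moment:
  assumes \<epsilon>: "noise_process \<epsilon>" and white: "white_noise \<epsilon>" and h: "0 < h"
  shows "(\<integral>\<omega>. (\<epsilon> h \<omega> - \<epsilon> 0 \<omega>)\<^sup>2 \<partial>M) = 2 * (\<integral>\<omega>. (\<epsilon> 0 \<omega>)\<^sup>2 \<partial>M)"
proof -
  have rv [measurable]: "\<epsilon> 0 \<in> borel_measurable M" "\<epsilon> h \<in> borel_measurable M"
    using \<epsilon> h by (auto simp: noise_process_def stochastic_process_def)
  have int: "integrable M (\<epsilon> t)" "integrable M (\<lambda>\<omega>. (\<epsilon> t \<omega>)\<^sup>2)" "expectation (\<epsilon> t) = 0"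
    if "t \<in> {0, h}" for t
    using noise_process_moments[OF \<epsilon>, of t] that h by auto
  have iv: "indep_vars (\<lambda>_. borel) \<epsilon> {0, h}"
    using white h unfolding white_noise_def by (auto intro: indep_vars_subset)
  \<comment> \<open>The product has two factors because \<open>h\<close> differs from 0.\<close>
  have prod: "(\<Prod>i\<in>{0, h}. \<epsilon> i \<omega>) = \<epsilon> 0 \<omega> * \<epsilon> h \<omega>" for \<omega>
    using h by simp
  have cross: "integrable M (\<lambda>\<omega>. \<epsilon> 0 \<omega> * \<epsilon> h \<omega>)" "(\<integral>\<omega>. \<epsilon> 0 \<omega> * \<epsilon> h \<omega> \<partial>M) = 0"
    using indep_vars_integrable[OF _ iv int(1)] indep_vars_lebesgue_integral[OF _ iv int(1)] int(3) h
    by (simp_all add: prod)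
  have "(\<integral>\<omega>. (\<epsilon> h \<omega>)\<^sup>2 \<partial>M) = (\<integral>x. x\<^sup>2 \<partial>distr M borel (\<epsilon> h))"
    by (simp add: integral_distr)
  also have "distr M borel (\<epsilon> h) = distr M borel (\<epsilon> 0)"
    using white h unfolding white_noise_def by simp
  also have "(\<integral>x. x\<^sup>2 \<partial>distr M borel (\<epsilon> 0)) = (\<integral>\<omega>. (\<epsilon> 0 \<omega>)\<^sup>2 \<partial>M)"
    by (simp add: integral_distr)
  finally have same: "(\<integral>\<omega>. (\<epsilon> h \<omega>)\<^sup>2 \<partial>M) = (\<integral>\<omega>. (\<epsilon> 0 \<omega>)\<^sup>2 \<partial>M)" .
  have "(\<integral>\<omega>. (\<epsilon> h \<omega> - \<epsilon> 0 \<omega>)\<^sup>2 \<partial>M)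
      = (\<integral>\<omega>. (\<epsilon> h \<omega>)\<^sup>2 + (\<epsilon> 0 \<omega>)\<^sup>2 - 2 * (\<epsilon> 0 \<omega> * \<epsilon> h \<omega>) \<partial>M)"
    by (simp add: power2_diff algebra_simps)
  also have "\<dots> = 2 * (\<integral>\<omega>. (\<epsilon> 0 \<omega>)\<^sup>2 \<partial>M)"
    using int(2)[of 0] int(2)[of h] cross same by simp
  finally show ?thesis .
qed

end

section \<open>Expectation of the two-scale estimator\<close>

lemma power_variation_expectation:
  assumes v: "\<And>s. 0 \<le> s \<Longrightarrow> has_bochner_integral M (\<lambda>\<omega>. (Y (s + h) \<omega> - Y s \<omega>)\<^sup>2) v"
    and len: "length G = Suc m"
    and step: "\<And>j. j < m \<Longrightarrow> 0 \<le> G ! j \<and> G ! Suc j = G ! j + h"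
  shows "has_bochner_integral M (power_variation 2 Y G) (real m * v)"
proof -
  have "has_bochner_integral M (\<lambda>\<omega>. \<Sum>j<m. (Y (G ! Suc j) \<omega> - Y (G ! j) \<omega>)\<^sup>2) (\<Sum>j<m. v)"
    using v step by (intro has_bochner_integral_sum) simp
  moreover have "power_variation 2 Y G = (\<lambda>\<omega>. \<Sum>j<m. (Y (G ! Suc j) \<omega> - Y (G ! j) \<omega>)\<^sup>2)"
    by (simp add: fun_eq_iff power_variation_def len)
  ultimately show ?thesis by simp
qed

text \<open>From \<open>2 * K - 1 \<le> n\<close> and \<open>i \<le> K\<close> at least
  \<open>K\<close> is left in \<open>n + 1 - i\<close>. This keeps the division by
  \<open>sub_horizon\<close> meaningful.\<close>

lemma sub_count_pos:
  assumes "admissible T n K" "1 \<le> i" "i \<le> K"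
  shows "0 < sub_count n K i"
proof -
  have "K \<le> n + 1 - i" "0 < K" using assms by (auto simp: admissible_def)
  then show ?thesis
    by (simp add: sub_count_def div_greater_zero_iff)
qed

text \<open>The count of a subgrid cancels against its horizon, so all \<open>K\<close> subgrids
  contribute equally. Since \<open>v\<close> is an arbitrary function of the lag, signal and noise
  are handled at once: the result is the difference quotient of \<open>v\<close> between the two
  lags, and a linear part of \<open>v\<close> contributes its slope.\<close>

lemma two_scale_estimator_expectation:
  assumes adm: "admissible T n K"
    and v: "\<And>s h. 0 \<le> s \<Longrightarrow> 0 < h \<Longrightarrow> has_bochner_integral M (\<lambda>\<omega>. (Y (s + h) \<omega> - Y s \<omega>)\<^sup>2) (v h)"
  shows "has_bochner_integral M (two_scale_estimator Y T n K)
           ((v (real K * mesh T n) - v (mesh T n)) / (mesh T n * (real K - 1)))"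
proof -
  let ?\<delta> = "mesh T n"
  have T: "0 < T" and K: "2 \<le> K" and n: "0 < n"
    using adm by (auto simp: admissible_def)
  have \<delta>: "0 < ?\<delta>"
    using T n by (simp add: mesh_def)
  have K\<delta>: "0 < real K * ?\<delta>" using K \<delta> by simp
  have full: "has_bochner_integral M (power_variation 2 Y (full_grid T n)) (real n * v ?\<delta>)"
  proof (rule power_variation_expectation[where Y=Y and h="?\<delta>", OF v[OF _ \<delta>]])
    fix j assume "j < n"
    then show "0 \<le> full_grid T n ! j \<and> full_grid T n ! Suc j = full_grid T n ! j + ?\<delta>"
      using \<delta> unfolding full_grid_def by (simp add: algebra_simps del: upt_Suc)
  qed (simp_all add: full_grid_def)
  have sub: "has_bochner_integral M (power_variation 2 Y (sub_grid T n K i))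
      (real (sub_count n K i) * v (real K * ?\<delta>))" for i
  proof (rule power_variation_expectation[where Y=Y and h="real K * ?\<delta>", OF v[OF _ K\<delta>]])
    fix j assume "j < sub_count n K i"
    then show "0 \<le> sub_grid T n K i ! j \<and> sub_grid T n K i ! Suc j = sub_grid T n K i ! j + real K * ?\<delta>"
      using \<delta> unfolding sub_grid_def by (simp add: algebra_simps del: upt_Suc)
  qed (simp_all add: sub_grid_def)
  have "has_bochner_integral M (two_scale_estimator Y T n K)
     (1 / (real K - 1) * (\<Sum>i=1..K. 1 / sub_horizon T n K i * (real (sub_count n K i) * v (real K * ?\<delta>)))
     - 1 / ((real K - 1) * T) * (real n * v ?\<delta>))"
    unfolding two_scale_estimator_def
    by (intro has_bochner_integral_diff has_bochner_integral_mult_right has_bochner_integral_sum full sub)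
  also have "(\<Sum>i=1..K. 1 / sub_horizon T n K i * (real (sub_count n K i) * v (real K * ?\<delta>)))
      = (\<Sum>i=1..K. v (real K * ?\<delta>) / (real K * ?\<delta>))"
  proof (rule sum.cong[OF refl])
    fix i assume "i \<in> {1..K}"
    then have "0 < sub_count n K i"
      using sub_count_pos[OF adm] by simp
    then show "1 / sub_horizon T n K i * (real (sub_count n K i) * v (real K * ?\<delta>))
        = v (real K * ?\<delta>) / (real K * ?\<delta>)"
      by (simp add: sub_horizon_def)
  qed
  also have "\<dots> = v (real K * ?\<delta>) / ?\<delta>"
    using K by simp
  also have "1 / ((real K - 1) * T) * (real n * v ?\<delta>) = (real n / T) * v ?\<delta> / (real K - 1)"
    by simp
  also have "real n / T = 1 / ?\<delta>"
    by (simp add: mesh_def)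
  also have "1 / (real K - 1) * (v (real K * ?\<delta>) / ?\<delta>) - 1 / ?\<delta> * v ?\<delta> / (real K - 1)
      = (v (real K * ?\<delta>) - v ?\<delta>) / (?\<delta> * (real K - 1))"
    by (simp add: diff_divide_distrib)
  finally show ?thesis .
qed

section \<open>The limiting regimes\<close>

lemma eventually_admissible_small_mesh:
  "eventually (\<lambda>(T, n, K). admissible T n K) small_mesh"
  unfolding small_mesh_def eventually_inf_principal inf_assoc[symmetric]
  by (auto intro: always_eventually)

text \<open>Links the regime of the estimator to the hypothesis on the noise: both lags tend to 0
  from the right, and they differ because the mesh is positive and \<open>K\<close> is at least
  2.\<close>

lemma filterlim_lags_small_pairs:
  "filterlim (\<lambda>(T, n, K). (mesh T n, real K * mesh T n)) small_pairs small_mesh"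
proof -
  have "filterlim (\<lambda>(T, n, K). mesh T n) (at_right 0) small_mesh"
    and "filterlim (\<lambda>(T, n, K). real K * mesh T n) (at_right 0) small_mesh"
    unfolding small_mesh_def filterlim_iff_le_filtercomap by (auto intro: le_infI1 le_infI2)
  from filterlim_Pair[OF this]
  have "filterlim (\<lambda>(T, n, K). (mesh T n, real K * mesh T n)) (at_right 0 \<times>\<^sub>F at_right 0) small_mesh"
    by (simp add: case_prod_beta')
  moreover have "eventually (\<lambda>(T, n, K). (mesh T n, real K * mesh T n) \<in> {(d1, d2). d1 \<noteq> d2}) small_mesh"
    using eventually_admissible_small_mesh by eventually_elim (auto simp: admissible_def mesh_def)
  ultimately show ?thesis
    unfolding small_pairs_def by (simp add: filterlim_inf filterlim_principal case_prod_beta')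
qed

text \<open>Shows that letting \<open>n\<close> grow with \<open>T\<close> and \<open>K\<close>
  fixed is a special case of \<open>small_mesh\<close>, so that the sequential limit follows by
  composition.\<close>

lemma filterlim_fixed_horizon_small_mesh:
  assumes "0 < T" "2 \<le> K"
  shows "filterlim (\<lambda>n. (T, n, K)) small_mesh sequentially"
proof -
  have "filterlim (\<lambda>n. T / real n) (at_right 0) sequentially"
    and "filterlim (\<lambda>n. real K * (T / real n)) (at_right 0) sequentially"
    using assms by real_asymp+
  moreover have "eventually (\<lambda>n. admissible T n K) sequentially"
    using eventually_ge_at_top[of "2 * K - 1"] by eventually_elim (use assms in \<open>simp add: admissible_def\<close>)
  ultimately show ?thesis
    unfolding small_mesh_def
    by (simp add: filterlim_inf filterlim_principal filterlim_filtercomap_iff comp_def mesh_def)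
qed

theorem proposition4p1:
  fixes M :: "'a measure" and N :: "'b measure"
    and \<sigma> \<kappa> :: real
    and W \<tau> \<epsilon> X Xt :: "real \<Rightarrow> 'a \<Rightarrow> real"
    and \<eta> :: "real \<Rightarrow> 'b \<Rightarrow> real"
  assumes "prob_space M"
    and "\<sigma> > 0" and "\<kappa> > 0"
    and "prob_space.brownian_motion M W"
    and "prob_space.subordinator M \<tau>"
    and "prob_space.indep_processes M W \<tau>"
    and "\<And>t. t \<ge> 0 \<Longrightarrow> has_bochner_integral M (\<tau> t) t"
    and "\<And>t. t \<ge> 0 \<Longrightarrow> prob_space.variance M (\<tau> t) = \<kappa> * t"
    and "\<And>j::nat. j \<in> {1..8} \<Longrightarrow> integrable M (\<lambda>\<omega>. \<tau> 1 \<omega> ^ j)"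
    and "\<And>t \<omega>. X t \<omega> = \<sigma> * W (\<tau> t \<omega>) \<omega>"
    and "prob_space.noise_process M \<epsilon>"
    and "prob_space.indep_processes M \<epsilon> X"
    and "\<And>t \<omega>. Xt t \<omega> = X t \<omega> + \<epsilon> t \<omega>"
    and "prob_space N"
    (* \<eta> \<delta> is a version of the noise increment over a lag \<delta>; by stationarity of \<epsilon>
       the starting time 0 is immaterial *)
    and "\<And>\<delta>. \<delta> > 0 \<Longrightarrow> \<eta> \<delta> \<in> borel_measurable N"
    and "\<And>\<delta>. \<delta> > 0 \<Longrightarrow> distr N borel (\<eta> \<delta>) = distr M borel (\<lambda>\<omega>. \<epsilon> \<delta> \<omega> - \<epsilon> 0 \<omega>)"
  shows
    "(\<forall>T n K. admissible T n K \<longrightarrow>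
        has_bochner_integral M (two_scale_estimator Xt T n K)
          (\<sigma>\<^sup>2 + (integral\<^sup>L N (\<lambda>\<omega>. (\<eta> (real K * mesh T n) \<omega>)\<^sup>2)
                  - integral\<^sup>L N (\<lambda>\<omega>. (\<eta> (mesh T n) \<omega>)\<^sup>2))
                 / (mesh T n * (real K - 1))))
     \<and> ((\<forall>l::nat. l \<ge> 1 \<longrightarrow>
           ((\<lambda>(d1, d2). (integral\<^sup>L N (\<lambda>\<omega>. \<eta> d2 \<omega> ^ l) - integral\<^sup>L N (\<lambda>\<omega>. \<eta> d1 \<omega> ^ l))
                        / (d2 - d1)) \<longlongrightarrow> 0) small_pairs)
        \<longrightarrow> asymptotically_unbiased M (two_scale_estimator Xt) (\<sigma>\<^sup>2)
            \<and> (\<forall>T K. T > 0 \<longrightarrow> K \<ge> 2 \<longrightarrow>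
                 (\<lambda>n. integral\<^sup>L M (two_scale_estimator Xt T n K)) \<longlonglongrightarrow> \<sigma>\<^sup>2))
     \<and> (prob_space.white_noise M \<epsilon> \<longrightarrow>
          (\<forall>T n K. admissible T n K \<longrightarrow> unbiased M (two_scale_estimator Xt T n K) (\<sigma>\<^sup>2)))"
proof -
  interpret M: prob_space M by fact
  note BM = assms(4) and sub = assms(5) and WT = assms(6) and mean = assms(7)
    and X_eq = assms(10) and noise = assms(11) and \<epsilon>X = assms(12) and Xt_eq = assms(13)
    and \<eta>_meas = assms(15) and \<eta>_law = assms(16)
  define q where "q = (\<lambda>h. \<integral>\<omega>. (\<eta> h \<omega>)\<^sup>2 \<partial>N)"
  have \<epsilon>_meas [measurable]: "\<epsilon> t \<in> borel_measurable M" if "0 \<le> t" for t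
    using M.indep_processes_measurable(1)[OF \<epsilon>X that] .
  \<comment> \<open>The noise moment passes between the spaces \<open>M\<close> and \<open>N\<close>
    through the common law on the real line.\<close>
  have q: "(\<integral>\<omega>. (\<epsilon> h \<omega> - \<epsilon> 0 \<omega>)\<^sup>2 \<partial>M) = q h" if h: "0 < h" for h
  proof -
    note [measurable] = \<eta>_meas[OF h] \<epsilon>_meas[OF less_imp_le[OF h]] \<epsilon>_meas[OF order_refl]
    have "q h = (\<integral>x. x\<^sup>2 \<partial>distr N borel (\<eta> h))"
      unfolding q_def by (simp add: integral_distr)
    also have "\<dots> = (\<integral>\<omega>. (\<epsilon> h \<omega> - \<epsilon> 0 \<omega>)\<^sup>2 \<partial>M)"
      unfolding \<eta>_law[OF h] by (simp add: integral_distr)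
    finally show ?thesis by simp
  qed
  \<comment> \<open>Independence of \<epsilon> and \<open>X\<close> includes measurability of each
    \<open>X t\<close>; division by \<sigma> > 0 recovers the time-changed Brownian motion.\<close>
  have W\<tau>_meas: "(\<lambda>\<omega>. W (\<tau> t \<omega>) \<omega>) \<in> borel_measurable M" if "0 \<le> t" for t
  proof -
    note [measurable] = M.indep_processes_measurable(2)[OF \<epsilon>X that]
    have "(\<lambda>\<omega>. W (\<tau> t \<omega>) \<omega>) = (\<lambda>\<omega>. X t \<omega> / \<sigma>)"
      using assms(2) by (simp add: X_eq)
    then show ?thesis by simp
  qed
  have incr: "has_bochner_integral M (\<lambda>\<omega>. (Xt (s + h) \<omega> - Xt s \<omega>)\<^sup>2) (\<sigma>\<^sup>2 * h + q h)"
    if s: "0 \<le> s" and h: "0 < h" for s h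
  proof -
    have "has_bochner_integral M (\<lambda>\<omega>. (W (\<tau> (s + h) \<omega>) \<omega> - W (\<tau> s \<omega>) \<omega>)\<^sup>2) (s + h - s)"
      using s h by (intro M.time_changed_brownian_second_moment[OF BM sub WT mean] W\<tau>_meas) auto
    then have "has_bochner_integral M (\<lambda>\<omega>. \<sigma>\<^sup>2 * (W (\<tau> (s + h) \<omega>) \<omega> - W (\<tau> s \<omega>) \<omega>)\<^sup>2) (\<sigma>\<^sup>2 * h)"
      by (intro has_bochner_integral_mult_right) simp
    then have "has_bochner_integral M (\<lambda>\<omega>. (X (s + h) \<omega> - X s \<omega>)\<^sup>2) (\<sigma>\<^sup>2 * h)"
      by (simp add: X_eq power_mult_distrib flip: right_diff_distrib)
    from M.observed_increment_second_moment[OF noise \<epsilon>X s less_imp_le[OF h] this]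
    show ?thesis by (simp add: Xt_eq q[OF h])
  qed
  define b where "b = (\<lambda>T n K. (q (real K * mesh T n) - q (mesh T n)) / (mesh T n * (real K - 1)))"
  have est: "has_bochner_integral M (two_scale_estimator Xt T n K) (\<sigma>\<^sup>2 + b T n K)"
    if adm: "admissible T n K" for T n K
  proof -
    have "0 < mesh T n" "1 < real K"
      using adm by (auto simp: admissible_def mesh_def)
    \<comment> \<open>The signal part of the numerator is \<open>\<sigma>\<^sup>2\<close> times the
      gap between the lags, which is the denominator.\<close>
    then have "(\<sigma>\<^sup>2 * (real K * mesh T n) + q (real K * mesh T n) - (\<sigma>\<^sup>2 * mesh T n + q (mesh T n)))
        / (mesh T n * (real K - 1)) = \<sigma>\<^sup>2 + b T n K"
      by (simp add: b_def field_simps)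
    with two_scale_estimator_expectation[OF adm incr] show ?thesis by simp
  qed
  have asymp: "asymptotically_unbiased M (two_scale_estimator Xt) (\<sigma>\<^sup>2)"
    if lim: "((\<lambda>(d1, d2). (q d2 - q d1) / (d2 - d1)) \<longlongrightarrow> 0) small_pairs"
  proof -
    \<comment> \<open>The gap between the lags equals \<open>mesh T n * (real K - 1)\<close>, so
      this quotient is exactly the bias \<open>b T n K\<close>.\<close>
    have "((\<lambda>(T, n, K). (q (real K * mesh T n) - q (mesh T n)) / (real K * mesh T n - mesh T n)) \<longlongrightarrow> 0) small_mesh"
      using filterlim_compose[OF lim filterlim_lags_small_pairs] by (simp add: case_prod_beta')
    moreover have "eventually (\<lambda>(T, n, K). admissible T n K) small_mesh"
      by (rule eventually_admissible_small_mesh)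
    then have "eventually (\<lambda>x. (case x of (T, n, K) \<Rightarrow>
          (q (real K * mesh T n) - q (mesh T n)) / (real K * mesh T n - mesh T n))
        = (case x of (T, n, K) \<Rightarrow> integral\<^sup>L M (two_scale_estimator Xt T n K) - \<sigma>\<^sup>2)) small_mesh"
      by eventually_elim
        (auto simp: b_def has_bochner_integral_integral_eq[OF est] algebra_simps)
    ultimately show ?thesis
      unfolding asymptotically_unbiased_def by (rule Lim_transform_eventually)
  qed
  have fixed: "(\<lambda>n. integral\<^sup>L M (two_scale_estimator Xt T n K)) \<longlonglongrightarrow> \<sigma>\<^sup>2"
    if "asymptotically_unbiased M (two_scale_estimator Xt) (\<sigma>\<^sup>2)" "0 < T" "2 \<le> K" for T K
    using filterlim_compose[OF that(1)[unfolded asymptotically_unbiased_def]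
        filterlim_fixed_horizon_small_mesh[OF that(2,3)]]
    by (simp add: LIM_zero_iff)
  have white: "unbiased M (two_scale_estimator Xt T n K) (\<sigma>\<^sup>2)"
    if wn: "M.white_noise \<epsilon>" and adm: "admissible T n K" for T n K
  proof -
    have "0 < mesh T n" "0 < real K * mesh T n"
      using adm by (auto simp: admissible_def mesh_def)
    then have "b T n K = 0"
      using M.white_noise_increment_second_moment[OF noise wn] q by (simp add: b_def)
    with est[OF adm] show ?thesis
      by (simp add: unbiased_def has_bochner_integral_iff)
  qed
  show ?thesis
  proof (intro conjI allI impI)
    fix T n K assume "admissible T n K"
    then show "has_bochner_integral M (two_scale_estimator Xt T n K)
          (\<sigma>\<^sup>2 + (integral\<^sup>L N (\<lambda>\<omega>. (\<eta> (real K * mesh T n) \<omega>)\<^sup>2)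
                  - integral\<^sup>L N (\<lambda>\<omega>. (\<eta> (mesh T n) \<omega>)\<^sup>2))
                 / (mesh T n * (real K - 1)))"
      using est by (simp add: b_def q_def)
  next
    assume "\<forall>l::nat. l \<ge> 1 \<longrightarrow>
           ((\<lambda>(d1, d2). (integral\<^sup>L N (\<lambda>\<omega>. \<eta> d2 \<omega> ^ l) - integral\<^sup>L N (\<lambda>\<omega>. \<eta> d1 \<omega> ^ l))
                        / (d2 - d1)) \<longlongrightarrow> 0) small_pairs"
    \<comment> \<open>For \<open>l = 2\<close> the hypothesis is the statement about the difference
      quotient of \<open>q\<close>.\<close>
    from this[rule_format, of 2] have au: "asymptotically_unbiased M (two_scale_estimator Xt) (\<sigma>\<^sup>2)"
      by (intro asymp) (simp add: q_def)
    then show "asymptotically_unbiased M (two_scale_estimator Xt) (\<sigma>\<^sup>2)" .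
    fix T :: real and K :: nat assume "T > 0" "K \<ge> 2"
    with au show "(\<lambda>n. integral\<^sup>L M (two_scale_estimator Xt T n K)) \<longlonglongrightarrow> \<sigma>\<^sup>2"
      by (rule fixed)
  qed (rule white)
qed

end
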